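(* Let $T$ be a left continuous t-norm on $[0,1]$ and $L$ be a continuous t-conorm on $[0,\infty]$. Then the following statements are equivalent: (1) $\tau_{T,L}$ is a triangle function on $\Delta^+$; (2) $\tau_{T,L}=L\otimes T$ (i.e. $\tau_{T,L}(f,g)=L\otimes T(f,g)$ for all $f,g\in\Delta^+$); (3) $L$ satisfies the property (LCS): for all $x,x',y,y'\in[0,\infty]$, if $x<x'$, $y<y'$ and $L(x',y')<\infty$, then $L(x,y)<L(x',y')$.
   Context: A distance distribution function (d.d.f.) is an increasing (i.e. non-decreasing) function $f:[0,\infty]\to[0,1]$ with $f(0)=0$, $f(\infty)=1$ that is left continuous on the open interval $]0,\infty[$. $\Delta^+$ is the set of all d.d.f.'s, ordered pointwise; it is a complete lattice in which suprema of non-empty families are computed pointwise. For $r\in[0,\infty]$, $p\in[0,1]$, the step function $\varepsilon(r,p)\in\Delta^+$ is given by $\varepsilon(r,p)(\infty)=1$, $\varepsilon(r,p)(x)=p$ for $r<x<\infty$, and $\varepsilon(r,p)(x)=0$ for $x\le r$, $x<\infty$; the top element of $\Delta^+$ is $\varepsilon(0,1)$ and the bottom is $\varepsilon(\infty,0)$. A triangle function is an associative binary operation on $\Delta^+$ (so its values lie in $\Delta^+$) that is commutative, increasing in each place, and has $\varepsilon(0,1)$ as identity. A t-norm $T$ is an associative, commutative binary operation on $[0,1]$, increasing in each place, with identity $1$; it is left continuous if it is left continuous as a function $[0,1]^2\to[0,1]$ (equivalently, it preserves arbitrary suprema in each variable). A t-conorm $L$ on $[0,\infty]$ is an associative, commutative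 binary operation on $[0,\infty]$, increasing in each place, with identity $0$; it is continuous if it is continuous for the usual topology on $[0,\infty]$; it is right continuous if it is right continuous as a function (equivalently, it preserves arbitrary infima in each variable); continuous t-conorms are right continuous. For $f,g\in\Delta^+$, $\tau_{T,L}(f,g):[0,\infty]\to[0,1]$ is $\tau_{T,L}(f,g)(x)=\sup_{L(s,t)=x}T(f(s),g(t))$. For $T$ a left continuous t-norm and $L$ a right continuous t-conorm, $L\otimes T$ is the binary operation on $\Delta^+$ that preserves arbitrary suprema in each variable and satisfies $L\otimes T(\varepsilon(r,p),\varepsilon(s,q))=\varepsilon(L(r,s),T(p,q))$ for all $r,s,p,q$; equivalently $L\otimes T(f,g)=\sup_{r,s\in[0,\infty]}\varepsilon(L(r,s),T(f(r),g(s)))$ (supremum in $\Delta^+$). *)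

theory Defs
  imports "HOL-Analysis.Analysis"
begin

text \<open>The interval $[0,\infty]$ is the type \<open>ennreal\<close>; the unit interval is the set \<open>{0..1}\<close> of reals.
  Operations on the unit interval are total functions on the reals of which only the values on
  \<open>{0..1}\<close> matter; likewise, operations on distance distribution functions only matter on \<open>ddfs\<close>.\<close>

section \<open>Distance distribution functions\<close>

definition ddfs :: "(ennreal \<Rightarrow> real) set" where
  "ddfs = {f. range f \<subseteq> {0..1} \<and> mono f \<and> f 0 = 0 \<and> f \<infinity> = 1 \<and>
              (\<forall>x. 0 < x \<and> x < \<infinity> \<longrightarrow> continuous (at_left x) f)}"

definition eps :: "ennreal \<Rightarrow> real \<Rightarrow> ennreal \<Rightarrow> real" where
  "eps r p x = (if x = \<infinity> then 1 else if r < x then p else 0)"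

definition is_ddf_sup :: "(ennreal \<Rightarrow> real) set \<Rightarrow> (ennreal \<Rightarrow> real) \<Rightarrow> bool" where
  "is_ddf_sup A h \<longleftrightarrow> h \<in> ddfs \<and> (\<forall>f\<in>A. f \<le> h) \<and> (\<forall>k\<in>ddfs. (\<forall>f\<in>A. f \<le> k) \<longrightarrow> h \<le> k)"

text \<open>The supremum in the complete lattice of distance distribution functions; the supremum of the
  empty family is the bottom element \<open>eps \<infinity> 0\<close>, not the zero function.\<close>

definition ddf_Sup :: "(ennreal \<Rightarrow> real) set \<Rightarrow> ennreal \<Rightarrow> real" where
  "ddf_Sup A = (THE h. is_ddf_sup A h)"

definition triangle_function ::
    "((ennreal \<Rightarrow> real) \<Rightarrow> (ennreal \<Rightarrow> real) \<Rightarrow> (ennreal \<Rightarrow> real)) \<Rightarrow> bool" where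
  "triangle_function F \<longleftrightarrow>
     (\<forall>f\<in>ddfs. \<forall>g\<in>ddfs. F f g \<in> ddfs) \<and>
     (\<forall>f\<in>ddfs. \<forall>g\<in>ddfs. \<forall>h\<in>ddfs. F (F f g) h = F f (F g h)) \<and>
     (\<forall>f\<in>ddfs. \<forall>g\<in>ddfs. F f g = F g f) \<and>
     (\<forall>f\<in>ddfs. \<forall>f'\<in>ddfs. \<forall>g\<in>ddfs. \<forall>g'\<in>ddfs. f \<le> f' \<and> g \<le> g' \<longrightarrow> F f g \<le> F f' g') \<and>
     (\<forall>f\<in>ddfs. F (eps 0 1) f = f \<and> F f (eps 0 1) = f)"


section \<open>t-norms and t-conorms\<close>

definition t_norm :: "(real \<Rightarrow> real \<Rightarrow> real) \<Rightarrow> bool" where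
  "t_norm T \<longleftrightarrow>
     (\<forall>x\<in>{0..1}. \<forall>y\<in>{0..1}. T x y \<in> {0..1}) \<and>
     (\<forall>x\<in>{0..1}. \<forall>y\<in>{0..1}. \<forall>z\<in>{0..1}. T (T x y) z = T x (T y z)) \<and>
     (\<forall>x\<in>{0..1}. \<forall>y\<in>{0..1}. T x y = T y x) \<and>
     (\<forall>x\<in>{0..1}. \<forall>x'\<in>{0..1}. \<forall>y\<in>{0..1}. \<forall>y'\<in>{0..1}. x \<le> x' \<and> y \<le> y' \<longrightarrow> T x y \<le> T x' y') \<and>
     (\<forall>x\<in>{0..1}. T 1 x = x \<and> T x 1 = x)"

definition left_continuous_op :: "(real \<Rightarrow> real \<Rightarrow> real) \<Rightarrow> bool" where
  "left_continuous_op T \<longleftrightarrow>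
     (\<forall>x\<in>{0..1}. \<forall>y\<in>{0..1}. continuous (at (x, y) within {0..x} \<times> {0..y}) (\<lambda>(s, t). T s t))"

definition t_conorm :: "(ennreal \<Rightarrow> ennreal \<Rightarrow> ennreal) \<Rightarrow> bool" where
  "t_conorm L \<longleftrightarrow>
     (\<forall>x y z. L (L x y) z = L x (L y z)) \<and>
     (\<forall>x y. L x y = L y x) \<and>
     (\<forall>x x' y y'. x \<le> x' \<and> y \<le> y' \<longrightarrow> L x y \<le> L x' y') \<and>
     (\<forall>x. L 0 x = x \<and> L x 0 = x)"

definition continuous_op :: "(ennreal \<Rightarrow> ennreal \<Rightarrow> ennreal) \<Rightarrow> bool" where
  "continuous_op L \<longleftrightarrow> continuous_on UNIV (\<lambda>(s, t). L s t)"

definition right_continuous_op :: "(ennreal \<Rightarrow> ennreal \<Rightarrow> ennreal) \<Rightarrow> bool" where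
  "right_continuous_op L \<longleftrightarrow>
     (\<forall>x y. continuous (at (x, y) within {x..} \<times> {y..}) (\<lambda>(s, t). L s t))"

definition LCS :: "(ennreal \<Rightarrow> ennreal \<Rightarrow> ennreal) \<Rightarrow> bool" where
  "LCS L \<longleftrightarrow> (\<forall>x x' y y'. x < x' \<and> y < y' \<and> L x' y' < \<infinity> \<longrightarrow> L x y < L x' y')"


section \<open>The two operations\<close>

definition tau :: "(real \<Rightarrow> real \<Rightarrow> real) \<Rightarrow> (ennreal \<Rightarrow> ennreal \<Rightarrow> ennreal) \<Rightarrow>
    (ennreal \<Rightarrow> real) \<Rightarrow> (ennreal \<Rightarrow> real) \<Rightarrow> ennreal \<Rightarrow> real" where
  "tau T L f g x = Sup {T (f s) (g t) | s t. L s t = x}"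

text \<open>For left continuous \<open>T\<close> and right continuous \<open>L\<close>, the theorems \<open>is_tensor_tensor\<close> and
  \<open>is_tensor_unique\<close> below show that \<open>tensor L T\<close> is the unique operation on \<open>ddfs\<close> that
  preserves arbitrary suprema in each variable and acts on step functions through \<open>L\<close> and \<open>T\<close>.\<close>

definition tensor :: "(ennreal \<Rightarrow> ennreal \<Rightarrow> ennreal) \<Rightarrow> (real \<Rightarrow> real \<Rightarrow> real) \<Rightarrow>
    (ennreal \<Rightarrow> real) \<Rightarrow> (ennreal \<Rightarrow> real) \<Rightarrow> ennreal \<Rightarrow> real" where
  "tensor L T f g = ddf_Sup {eps (L r s) (T (f r) (g s)) | r s. True}"

definition is_tensor :: "(ennreal \<Rightarrow> ennreal \<Rightarrow> ennreal) \<Rightarrow> (real \<Rightarrow> real \<Rightarrow> real) \<Rightarrow>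
    ((ennreal \<Rightarrow> real) \<Rightarrow> (ennreal \<Rightarrow> real) \<Rightarrow> (ennreal \<Rightarrow> real)) \<Rightarrow> bool" where
  "is_tensor L T F \<longleftrightarrow>
     (\<forall>f\<in>ddfs. \<forall>g\<in>ddfs. F f g \<in> ddfs) \<and>
     (\<forall>A\<subseteq>ddfs. \<forall>g\<in>ddfs. F (ddf_Sup A) g = ddf_Sup ((\<lambda>f. F f g) ` A)) \<and>
     (\<forall>f\<in>ddfs. \<forall>B\<subseteq>ddfs. F f (ddf_Sup B) = ddf_Sup (F f ` B)) \<and>
     (\<forall>r s. \<forall>p\<in>{0..1}. \<forall>q\<in>{0..1}. F (eps r p) (eps s q) = eps (L r s) (T p q))"


section \<open>Suprema of distance distribution functions\<close>

lemma left_continuous_mono_iff: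
  fixes f :: "ennreal \<Rightarrow> real"
  assumes "mono f" "0 < x"
  shows "continuous (at_left x) f \<longleftrightarrow> (\<forall>a<f x. \<exists>y<x. a < f y)"
proof
  assume "continuous (at_left x) f"
  hence *: "(f \<longlongrightarrow> f x) (at_left x)" by (simp add: continuous_within)
  show "\<forall>a<f x. \<exists>y<x. a < f y"
  proof (intro allI impI)
    fix a assume "a < f x"
    hence "eventually (\<lambda>y. a < f y) (at_left x)" using * by (simp add: order_tendsto_iff)
    hence "\<exists>b<x. \<forall>y>b. y < x \<longrightarrow> a < f y"
      by (simp only: eventually_at_left[OF assms(2)])
    then obtain b where "b < x" "\<forall>y>b. y < x \<longrightarrow> a < f y" by blast
    moreover obtain y where "b < y" "y < x" using dense[OF \<open>b < x\<close>] by blast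
    ultimately show "\<exists>y<x. a < f y" by blast
  qed
next
  assume *: "\<forall>a<f x. \<exists>y<x. a < f y"
  have "(f \<longlongrightarrow> f x) (at_left x)"
  proof (rule order_tendstoI)
    fix a assume "a < f x"
    then obtain y where y: "y < x" "a < f y" using * by blast
    have "a < f z" if "y < z" for z
      using y(2) monoD[OF assms(1), of y z] that by (simp add: less_imp_le)
    thus "eventually (\<lambda>y. a < f y) (at_left x)"
      unfolding eventually_at_left[OF assms(2)] using y(1) by blast
  next
    fix a assume a: "f x < a"
    have "f z < a" if "z < x" for z
      using a monoD[OF assms(1), of z x] that by (simp add: less_imp_le)
    thus "eventually (\<lambda>y. f y < a) (at_left x)"
      unfolding eventually_at_left[OF assms(2)] using assms(2) by blast
  qed
  thus "continuous (at_left x) f" by (simp add: continuous_within)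
qed

lemma ddfs_iff:
  "f \<in> ddfs \<longleftrightarrow> (\<forall>x. 0 \<le> f x \<and> f x \<le> 1) \<and> mono f \<and> f 0 = 0 \<and> f \<infinity> = 1 \<and>
     (\<forall>x. 0 < x \<and> x < \<infinity> \<longrightarrow> (\<forall>a<f x. \<exists>y<x. a < f y))"
  unfolding ddfs_def using left_continuous_mono_iff[of f] by (auto simp: image_subset_iff)

lemma ddfsD:
  assumes "f \<in> ddfs"
  shows "0 \<le> f x" "f x \<le> 1" "x \<le> y \<Longrightarrow> f x \<le> f y" "f 0 = 0" "f \<infinity> = 1"
    "0 < x \<Longrightarrow> x < \<infinity> \<Longrightarrow> a < f x \<Longrightarrow> \<exists>y<x. a < f y"
  using assms unfolding ddfs_iff mono_def by auto

lemma eps_in_ddfs: "p \<in> {0..1} \<Longrightarrow> eps r p \<in> ddfs"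
  unfolding ddfs_iff
proof (intro conjI allI impI)
  assume p: "p \<in> {0..1}"
  show "mono (eps r p)" using p by (auto simp: mono_def eps_def top.extremum_unique)
  fix x a assume x: "0 < x \<and> x < \<infinity>" and a: "a < eps r p x"
  show "\<exists>y<x. a < eps r p y"
  proof (cases "r < x")
    case True
    then obtain y where "r < y" "y < x" using dense by blast
    moreover have "x \<noteq> \<infinity>" "y \<noteq> \<infinity>" using x \<open>y < x\<close> by auto
    ultimately show ?thesis using a True by (intro exI[of _ y]) (simp add: eps_def)
  next
    case False
    moreover have "x \<noteq> \<infinity>" using x by auto
    ultimately show ?thesis using a x by (intro exI[of _ 0]) (simp add: eps_def)
  qed
qed (auto simp: eps_def)

lemma is_ddf_sup_pointwise:
  assumes "A \<subseteq> ddfs"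
  shows "is_ddf_sup A (\<lambda>x. SUP f\<in>insert (eps \<infinity> 0) A. f x)"
proof -
  define B where "B = insert (eps \<infinity> 0) A"
  define h where "h = (\<lambda>x. SUP f\<in>B. f x)"
  have B: "B \<subseteq> ddfs" "B \<noteq> {}" using assms eps_in_ddfs[of 0] by (auto simp: B_def)
  have bdd: "bdd_above ((\<lambda>f. f x) ` B)" for x
    using B ddfsD(2) by (intro bdd_aboveI[of _ 1]) blast
  have ub: "f x \<le> h x" if "f \<in> B" for f x
    unfolding h_def using bdd that by (rule cSUP_upper2) simp
  have lub: "h x \<le> c" if "\<And>f. f \<in> B \<Longrightarrow> f x \<le> c" for x c
    unfolding h_def using B that by (intro cSUP_least) auto
  have lt: "\<exists>f\<in>B. a < f x" if "a < h x" for a x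
    using that B bdd unfolding h_def by (subst (asm) less_cSUP_iff) auto
  obtain f0 where f0: "f0 \<in> B" using B by blast
  have nn: "0 \<le> h x" for x using ub[OF f0, of x] ddfsD(1)[of f0 x] B f0 by (meson order_trans subsetD)
  have "h \<in> ddfs"
    unfolding ddfs_iff
  proof (intro conjI allI impI)
    show "h x \<le> 1" for x by (rule lub) (use B ddfsD(2) in blast)
    show "mono h"
    proof (intro monoI lub)
      fix x y :: ennreal and f assume "x \<le> y" "f \<in> B"
      hence "f x \<le> f y" "f y \<le> h y" using B ub ddfsD(3) by blast+
      thus "f x \<le> h y" by simp
    qed
    have "h 0 \<le> 0" by (rule lub) (use B ddfsD(4) in fastforce)
    thus "h 0 = 0" using nn[of 0] by simp
    have "h \<infinity> \<le> 1" by (rule lub) (use B ddfsD(2) in blast)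
    moreover have "1 \<le> h \<infinity>" using ub[OF f0, of \<infinity>] B f0 ddfsD(5)[of f0] by auto
    ultimately show "h \<infinity> = 1" by simp
    fix x a assume x: "0 < x \<and> x < \<infinity>" and "a < h x"
    then obtain f where f: "f \<in> B" "a < f x" using lt by blast
    then obtain y where "y < x" "a < f y" using ddfsD(6)[of f x a] B x by blast
    thus "\<exists>y<x. a < h y" using ub[OF f(1), of y] by (meson less_le_trans)
  qed (rule nn)
  moreover have "eps \<infinity> 0 \<le> k" if "k \<in> ddfs" for k
    using ddfsD[OF that] by (auto simp: le_fun_def eps_def)
  ultimately have "is_ddf_sup A h"
    using ub lub unfolding is_ddf_sup_def le_fun_def B_def by blast
  thus ?thesis by (simp add: h_def B_def)
qed

lemma ddf_Sup_eq: "is_ddf_sup A h \<Longrightarrow> ddf_Sup A = h"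
  unfolding ddf_Sup_def by (rule the_equality) (auto simp: is_ddf_sup_def intro: antisym)

lemma is_ddf_sup_ddf_Sup: "A \<subseteq> ddfs \<Longrightarrow> is_ddf_sup A (ddf_Sup A)"
  using is_ddf_sup_pointwise[of A] ddf_Sup_eq[OF is_ddf_sup_pointwise[of A]] by simp

lemma ddf_Sup_pointwise:
  assumes "A \<subseteq> ddfs" "A \<noteq> {}"
  shows "ddf_Sup A x = (SUP f\<in>A. f x)"
proof -
  have bdd: "bdd_above ((\<lambda>f. f x) ` A)"
    using assms ddfsD(2) by (intro bdd_aboveI[of _ 1]) blast
  obtain f0 where f0: "f0 \<in> A" using assms by blast
  have "eps \<infinity> 0 x \<le> f0 x" using assms f0 ddfsD(1,5)[of f0] by (auto simp: eps_def)
  also have "f0 x \<le> (SUP f\<in>A. f x)" by (rule cSUP_upper[OF f0 bdd])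
  finally have "(SUP f\<in>insert (eps \<infinity> 0) A. f x) = (SUP f\<in>A. f x)"
    using assms bdd by (subst cSUP_insert) (auto simp: sup_absorb2)
  thus ?thesis by (simp only: ddf_Sup_eq[OF is_ddf_sup_pointwise[OF assms(1)]])
qed

lemma ddf_Sup_le_iff:
  "A \<subseteq> ddfs \<Longrightarrow> k \<in> ddfs \<Longrightarrow> ddf_Sup A \<le> k \<longleftrightarrow> (\<forall>f\<in>A. f \<le> k)"
proof
  assume "A \<subseteq> ddfs" and le: "ddf_Sup A \<le> k"
  hence "f \<le> ddf_Sup A" if "f \<in> A" for f
    using is_ddf_sup_ddf_Sup[of A] that by (simp add: is_ddf_sup_def)
  thus "\<forall>f\<in>A. f \<le> k" using le order_trans by blast
next
  assume "A \<subseteq> ddfs" "k \<in> ddfs" "\<forall>f\<in>A. f \<le> k"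
  thus "ddf_Sup A \<le> k"
    using is_ddf_sup_ddf_Sup[of A] by (simp add: is_ddf_sup_def)
qed

lemma ddf_Sup_in_ddfs: "A \<subseteq> ddfs \<Longrightarrow> ddf_Sup A \<in> ddfs"
  using is_ddf_sup_ddf_Sup[of A] by (simp add: is_ddf_sup_def)

lemma ddf_eqI:
  assumes "f \<in> ddfs" "g \<in> ddfs" "\<And>k. k \<in> ddfs \<Longrightarrow> f \<le> k \<longleftrightarrow> g \<le> k"
  shows "f = g"
  using assms(3)[OF assms(1)] assms(3)[OF assms(2)] by (intro antisym) auto

lemma eps_le_iff:
  assumes "k \<in> ddfs"
  shows "eps r p \<le> k \<longleftrightarrow> (\<forall>x. r < x \<and> x < \<infinity> \<longrightarrow> p \<le> k x)"
  using ddfsD(1,5)[OF assms] by (auto simp: le_fun_def eps_def simp flip: less_top)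

lemma ddf_eq_Sup_eps:
  assumes f: "f \<in> ddfs"
  shows "f = ddf_Sup (range (\<lambda>r. eps r (f r)))"
proof (rule ddf_eqI)
  have sub: "range (\<lambda>r. eps r (f r)) \<subseteq> ddfs" using ddfsD(1,2)[OF f] eps_in_ddfs by auto
  show "ddf_Sup (range (\<lambda>r. eps r (f r))) \<in> ddfs" using sub by (rule ddf_Sup_in_ddfs)
  fix k assume k: "k \<in> ddfs"
  have "f \<le> k \<longleftrightarrow> (\<forall>r x. r < x \<and> x < \<infinity> \<longrightarrow> f r \<le> k x)"
  proof
    assume le: "f \<le> k"
    have "f r \<le> k x" if "r < x" for r x
      using le_funD[OF le, of r] ddfsD(3)[OF k, of r x] that by (simp add: less_imp_le)
    thus "\<forall>r x. r < x \<and> x < \<infinity> \<longrightarrow> f r \<le> k x" by blast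
  next
    assume *: "\<forall>r x. r < x \<and> x < \<infinity> \<longrightarrow> f r \<le> k x"
    show "f \<le> k"
    proof (rule le_funI)
      fix x :: ennreal
      consider "x = 0" | "x = \<infinity>" | "0 < x" "x < \<infinity>"
        by (cases "x = 0"; cases "x = \<infinity>") (auto simp: zero_less_iff_neq_zero simp flip: less_top)
      thus "f x \<le> k x"
      proof cases
        case 3
        show ?thesis
        proof (rule ccontr)
          assume "\<not> f x \<le> k x"
          then obtain y where "y < x" "k x < f y" using ddfsD(6)[OF f 3, of "k x"] by auto
          thus False using * 3 by fastforce
        qed
      qed (use ddfsD(4,5)[OF f] ddfsD(4,5)[OF k] in auto)
    qed
  qed
  thus "f \<le> k \<longleftrightarrow> ddf_Sup (range (\<lambda>r. eps r (f r))) \<le> k"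
    using ddf_Sup_le_iff[OF sub k] eps_le_iff[OF k] by auto
qed (rule f)


section \<open>Existence and uniqueness of the tensor operation\<close>

lemma t_normD:
  assumes "t_norm T" "x \<in> {0..1}" "y \<in> {0..1}"
  shows "T x y \<in> {0..1}" "T x y = T y x" "T 0 y = 0"
    "x' \<in> {0..1} \<Longrightarrow> y' \<in> {0..1} \<Longrightarrow> x \<le> x' \<Longrightarrow> y \<le> y' \<Longrightarrow> T x y \<le> T x' y'"
proof -
  show "T x y \<in> {0..1}" "T x y = T y x"
    "x' \<in> {0..1} \<Longrightarrow> y' \<in> {0..1} \<Longrightarrow> x \<le> x' \<Longrightarrow> y \<le> y' \<Longrightarrow> T x y \<le> T x' y'"
    using assms unfolding t_norm_def by blast+
  have z: "(0::real) \<in> {0..1}" "(1::real) \<in> {0..1}" "y \<le> 1" using assms by auto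
  have "T 0 y \<le> T 0 1" "T 0 1 = 0" "T 0 y \<in> {0..1}"
    using assms z unfolding t_norm_def by blast+
  thus "T 0 y = 0" by simp
qed

lemma t_conormD:
  assumes "t_conorm L"
  shows "L x \<infinity> = \<infinity>" "L \<infinity> x = \<infinity>" "x \<le> x' \<Longrightarrow> y \<le> y' \<Longrightarrow> L x y \<le> L x' y'" "L x y = L y x"
proof -
  show "x \<le> x' \<Longrightarrow> y \<le> y' \<Longrightarrow> L x y \<le> L x' y'" "L x y = L y x"
    using assms unfolding t_conorm_def by blast+
  have "L 0 \<infinity> \<le> L x \<infinity>" "L 0 \<infinity> = \<infinity>" "L x \<infinity> = L \<infinity> x"
    using assms zero_le[of x] order_refl[of "\<infinity>::ennreal"] unfolding t_conorm_def by blast+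
  thus "L x \<infinity> = \<infinity>" "L \<infinity> x = \<infinity>" by (auto simp: top.extremum_unique)
qed

lemma t_norm_Sup_le:
  assumes T: "t_norm T" "left_continuous_op T"
    and S: "S \<subseteq> {0..1}" "S \<noteq> {}" and q: "q \<in> {0..1}" and le: "\<And>p. p \<in> S \<Longrightarrow> T p q \<le> c"
  shows "T (Sup S) q \<le> c"
proof (rule ccontr)
  assume c: "\<not> T (Sup S) q \<le> c"
  have bdd: "bdd_above S" using S by (meson bdd_above_Icc bdd_above_mono)
  have m: "Sup S \<in> {0..1}"
  proof -
    obtain p where p: "p \<in> S" using S by blast
    hence "p \<le> Sup S" using bdd by (simp add: cSup_upper)
    moreover have "Sup S \<le> 1" using S by (intro cSup_least) auto
    ultimately show ?thesis using p S by auto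
  qed
  have "continuous (at (Sup S, q) within {0..Sup S} \<times> {0..q}) (\<lambda>(s, t). T s t)"
    using T(2) m q unfolding left_continuous_op_def by blast
  hence "((\<lambda>(s, t). T s t) \<longlongrightarrow> T (Sup S) q) (at (Sup S, q) within {0..Sup S} \<times> {0..q})"
    by (simp add: continuous_within)
  hence "eventually (\<lambda>z. c < (\<lambda>(s, t). T s t) z) (at (Sup S, q) within {0..Sup S} \<times> {0..q})"
    using c by (intro order_tendstoD(1)) auto
  then obtain d where d: "d > 0" and
    *: "\<And>z. z \<in> {0..Sup S} \<times> {0..q} \<Longrightarrow> z \<noteq> (Sup S, q) \<Longrightarrow> dist z (Sup S, q) < d \<Longrightarrow>
          c < (\<lambda>(s, t). T s t) z"
    unfolding eventually_at by blast
  have "Sup S - d < Sup S" using d by simp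
  then obtain p where p: "p \<in> S" "Sup S - d < p" using less_cSupD S by blast
  have pS: "p \<le> Sup S" using p bdd by (simp add: cSup_upper)
  have "c < T p q"
  proof (cases "p = Sup S")
    case False
    thus ?thesis using *[of "(p, q)"] p pS S q by (auto simp: dist_Pair_Pair dist_real_def)
  qed (use c in simp)
  thus False using le[OF p(1)] by simp
qed

lemma t_conorm_less_ex:
  assumes L: "right_continuous_op L" and lt: "L r s < x" and rs: "r < \<infinity>" "s < \<infinity>"
  shows "\<exists>a>r. \<exists>b>s. L a b < x"
proof -
  have "continuous (at (r, s) within {r..} \<times> {s..}) (\<lambda>(s, t). L s t)"
    using L unfolding right_continuous_op_def by blast
  hence "((\<lambda>(s, t). L s t) \<longlongrightarrow> L r s) (at (r, s) within {r..} \<times> {s..})"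
    by (simp add: continuous_within)
  hence "eventually (\<lambda>z. (\<lambda>(s, t). L s t) z < x) (at (r, s) within {r..} \<times> {s..})"
    using lt by (intro order_tendstoD(2)) auto
  then obtain W where W: "open W" "(r, s) \<in> W"
    and *: "\<And>z. z \<in> W \<Longrightarrow> z \<noteq> (r, s) \<Longrightarrow> z \<in> {r..} \<times> {s..} \<Longrightarrow> (\<lambda>(s, t). L s t) z < x"
    unfolding eventually_at_topological by blast
  obtain U V where UV: "open U" "open V" "(r, s) \<in> U \<times> V" "U \<times> V \<subseteq> W"
    using open_prod_elim[OF W] by blast
  obtain a' where a': "a' > r" "{r..<a'} \<subseteq> U" using open_right[OF UV(1), of r \<infinity>] UV(3) rs by auto
  obtain b' where b': "b' > s" "{s..<b'} \<subseteq> V" using open_right[OF UV(2), of s \<infinity>] UV(3) rs by auto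
  obtain a where a: "r < a" "a < a'" using dense[OF a'(1)] by blast
  obtain b where b: "s < b" "b < b'" using dense[OF b'(1)] by blast
  have "a \<in> {r..<a'}" "b \<in> {s..<b'}" using a b by auto
  hence "(a, b) \<in> W" using a'(2) b'(2) UV(4) by blast
  hence "L a b < x" using *[of "(a, b)"] a(1) b(1) by fastforce
  thus ?thesis using a b by blast
qed

lemma continuous_imp_right_continuous_op: "continuous_op L \<Longrightarrow> right_continuous_op L"
  unfolding continuous_op_def right_continuous_op_def
  by (auto simp: continuous_on_eq_continuous_within intro: continuous_within_subset)

lemma tensor_family:
  assumes T: "t_norm T" and "f \<in> ddfs" "g \<in> ddfs"
  shows "{eps (L r s) (T (f r) (g s)) | r s. True} \<subseteq> ddfs"
proof -
  have "T (f r) (g s) \<in> {0..1}" for r s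
    using ddfsD(1,2)[OF assms(2)] ddfsD(1,2)[OF assms(3)] by (intro t_normD(1)[OF T]) auto
  thus ?thesis using eps_in_ddfs by blast
qed

lemma tensor_in_ddfs: "t_norm T \<Longrightarrow> f \<in> ddfs \<Longrightarrow> g \<in> ddfs \<Longrightarrow> tensor L T f g \<in> ddfs"
  unfolding tensor_def by (intro ddf_Sup_in_ddfs tensor_family)

lemma tensor_le_iff:
  assumes "t_norm T" "f \<in> ddfs" "g \<in> ddfs" "k \<in> ddfs"
  shows "tensor L T f g \<le> k \<longleftrightarrow> (\<forall>r s x. L r s < x \<and> x < \<infinity> \<longrightarrow> T (f r) (g s) \<le> k x)"
  unfolding tensor_def ddf_Sup_le_iff[OF tensor_family[OF assms(1-3)] assms(4)]
  using eps_le_iff[OF assms(4)] by blast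

lemma tensor_commute_le:
  assumes T: "t_norm T" and L: "t_conorm L" and f: "f \<in> ddfs" and g: "g \<in> ddfs"
    and k: "k \<in> ddfs" and le: "tensor L T f g \<le> k"
  shows "tensor L T g f \<le> k"
  unfolding tensor_le_iff[OF T g f k]
proof (intro allI impI)
  fix r s x assume "L r s < x \<and> x < \<infinity>"
  hence "L s r < x \<and> x < \<infinity>" using t_conormD(4)[OF L, of r s] by simp
  hence "T (f s) (g r) \<le> k x" using le unfolding tensor_le_iff[OF T f g k] by blast
  moreover have "T (f s) (g r) = T (g r) (f s)"
    using ddfsD(1,2)[OF f] ddfsD(1,2)[OF g] by (intro t_normD(2)[OF T]) auto
  ultimately show "T (g r) (f s) \<le> k x" by simp
qed

lemma tensor_commute:
  assumes "t_norm T" "t_conorm L" "f \<in> ddfs" "g \<in> ddfs"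
  shows "tensor L T f g = tensor L T g f"
  using tensor_commute_le[OF assms(1,2,3,4)] tensor_commute_le[OF assms(1,2,4,3)]
  by (intro ddf_eqI tensor_in_ddfs assms) blast

lemma tensor_Sup_left:
  assumes T: "t_norm T" "left_continuous_op T" and L: "t_conorm L"
    and A: "A \<subseteq> ddfs" and g: "g \<in> ddfs"
  shows "tensor L T (ddf_Sup A) g = ddf_Sup ((\<lambda>f. tensor L T f g) ` A)"
proof (rule ddf_eqI)
  have sA: "ddf_Sup A \<in> ddfs" by (rule ddf_Sup_in_ddfs[OF A])
  have sub: "(\<lambda>f. tensor L T f g) ` A \<subseteq> ddfs" using A g tensor_in_ddfs[OF T(1)] by auto
  show "tensor L T (ddf_Sup A) g \<in> ddfs" using sA g tensor_in_ddfs[OF T(1)] by auto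
  show "ddf_Sup ((\<lambda>f. tensor L T f g) ` A) \<in> ddfs" using sub by (rule ddf_Sup_in_ddfs)
  fix k assume k: "k \<in> ddfs"
  have gI: "g s \<in> {0..1}" for s using ddfsD(1,2)[OF g] by auto
  have "tensor L T (ddf_Sup A) g \<le> k \<longleftrightarrow> (\<forall>f\<in>A. tensor L T f g \<le> k)"
  proof
    assume *: "tensor L T (ddf_Sup A) g \<le> k"
    show "\<forall>f\<in>A. tensor L T f g \<le> k"
    proof
      fix f assume f: "f \<in> A"
      hence fd: "f \<in> ddfs" and le: "f \<le> ddf_Sup A"
        using A is_ddf_sup_ddf_Sup[OF A] by (auto simp: is_ddf_sup_def)
      have mono: "T (f r) (g s) \<le> T (ddf_Sup A r) (g s)" for r s
        using ddfsD(1,2)[OF fd] ddfsD(1,2)[OF sA] gI le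
        by (intro t_normD(4)[OF T(1)]) (auto simp: le_fun_def)
      show "tensor L T f g \<le> k"
        using * order_trans[OF mono]
        unfolding tensor_le_iff[OF T(1) sA g k] tensor_le_iff[OF T(1) fd g k] by blast
    qed
  next
    assume *: "\<forall>f\<in>A. tensor L T f g \<le> k"
    show "tensor L T (ddf_Sup A) g \<le> k"
      unfolding tensor_le_iff[OF T(1) sA g k]
    proof (intro allI impI)
      fix r s x assume x: "L r s < x \<and> x < \<infinity>"
      have r: "r \<noteq> \<infinity>" using x t_conormD(2)[OF L, of s] by auto
      let ?S = "(\<lambda>f. f r) ` insert (eps \<infinity> 0) A"
      have eq: "ddf_Sup A r = Sup ?S"
        by (simp only: ddf_Sup_eq[OF is_ddf_sup_pointwise[OF A]])
      have "T p (g s) \<le> k x" if p: "p \<in> ?S" for p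
      proof -
        consider "p = eps \<infinity> 0 r" | f where "f \<in> A" "p = f r" using p by auto
        thus ?thesis
        proof cases
          case 1
          hence "p = 0" using r by (simp add: eps_def)
          thus ?thesis using t_normD(3)[OF T(1) gI gI] ddfsD(1)[OF k] by simp
        next
          case 2
          hence fd: "f \<in> ddfs" using A by auto
          have "tensor L T f g \<le> k" using * 2(1) by blast
          thus ?thesis using 2(2) x unfolding tensor_le_iff[OF T(1) fd g k] by blast
        qed
      qed
      moreover have "?S \<subseteq> {0..1}" using A r ddfsD(1,2)[of _ r] by (auto simp: eps_def subset_iff)
      ultimately show "T (ddf_Sup A r) (g s) \<le> k x"
        unfolding eq using gI by (intro t_norm_Sup_le[OF T]) auto
    qed
  qed
  thus "tensor L T (ddf_Sup A) g \<le> k \<longleftrightarrow> ddf_Sup ((\<lambda>f. tensor L T f g) ` A) \<le> k"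
    using ddf_Sup_le_iff[OF sub k] by auto
qed

lemma tensor_eps:
  assumes T: "t_norm T" and L: "t_conorm L" "right_continuous_op L"
    and p: "p \<in> {0..1}" and q: "q \<in> {0..1}"
  shows "tensor L T (eps r p) (eps s q) = eps (L r s) (T p q)"
proof (rule ddf_eqI)
  note e = eps_in_ddfs[OF p, of r] eps_in_ddfs[OF q, of s]
  have pq: "T p q \<in> {0..1}" by (rule t_normD(1)[OF T p q])
  show "tensor L T (eps r p) (eps s q) \<in> ddfs" by (rule tensor_in_ddfs[OF T e])
  show "eps (L r s) (T p q) \<in> ddfs" by (rule eps_in_ddfs[OF pq])
  fix k assume k: "k \<in> ddfs"
  have fin: "a < \<infinity> \<and> b < \<infinity>" if "L a b < x" for a b x
  proof -
    have "a \<noteq> \<infinity>" "b \<noteq> \<infinity>" using that t_conormD(1,2)[OF L(1)] by auto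
    thus ?thesis by (simp flip: less_top)
  qed
  show "tensor L T (eps r p) (eps s q) \<le> k \<longleftrightarrow> eps (L r s) (T p q) \<le> k"
    unfolding tensor_le_iff[OF T e k] eps_le_iff[OF k]
  proof (intro iffI allI impI)
    fix x assume *: "\<forall>r' s' x. L r' s' < x \<and> x < \<infinity> \<longrightarrow> T (eps r p r') (eps s q s') \<le> k x"
      and x: "L r s < x \<and> x < \<infinity>"
    obtain a b where ab: "r < a" "s < b" "L a b < x"
      using t_conorm_less_ex[OF L(2)] x fin by blast
    hence "T (eps r p a) (eps s q b) \<le> k x" using * x by blast
    moreover have "a \<noteq> \<infinity>" "b \<noteq> \<infinity>" using fin[OF ab(3)] by auto
    ultimately show "T p q \<le> k x" using ab by (simp add: eps_def)
  next
    fix a b x assume *: "\<forall>x. L r s < x \<and> x < \<infinity> \<longrightarrow> T p q \<le> k x" and x: "L a b < x \<and> x < \<infinity>"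
    have ab: "a < \<infinity>" "b < \<infinity>" using x fin by blast+
    have z: "(0::real) \<in> {0..1}" by simp
    show "T (eps r p a) (eps s q b) \<le> k x"
    proof (cases "r < a \<and> s < b")
      case True
      hence "L r s \<le> L a b" by (intro t_conormD(3)[OF L(1)]) auto
      thus ?thesis using True ab x * by (auto simp: eps_def)
    next
      case False
      hence "T (eps r p a) (eps s q b) = 0"
        using ab t_normD(2,3)[OF T z p] t_normD(2,3)[OF T z q] t_normD(2,3)[OF T z z]
        by (auto simp: eps_def)
      thus ?thesis using ddfsD(1)[OF k] by simp
    qed
  qed
qed

theorem is_tensor_tensor:
  assumes T: "t_norm T" "left_continuous_op T" and L: "t_conorm L" "right_continuous_op L"
  shows "is_tensor L T (tensor L T)"
  unfolding is_tensor_def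
proof (intro conjI ballI allI impI)
  fix f B assume f: "f \<in> ddfs" and B: "B \<subseteq> ddfs"
  have "tensor L T f (ddf_Sup B) = tensor L T (ddf_Sup B) f"
    by (rule tensor_commute[OF T(1) L(1) f ddf_Sup_in_ddfs[OF B]])
  also have "\<dots> = ddf_Sup ((\<lambda>h. tensor L T h f) ` B)"
    by (rule tensor_Sup_left[OF T L(1) B f])
  also have "(\<lambda>h. tensor L T h f) ` B = tensor L T f ` B"
    using tensor_commute[OF T(1) L(1) _ f] B by (intro image_cong) auto
  finally show "tensor L T f (ddf_Sup B) = ddf_Sup (tensor L T f ` B)" .
next
  show "tensor L T f g \<in> ddfs" if "f \<in> ddfs" "g \<in> ddfs" for f g
    using T(1) that by (rule tensor_in_ddfs)
  show "tensor L T (ddf_Sup A) g = ddf_Sup ((\<lambda>f. tensor L T f g) ` A)"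
    if "A \<subseteq> ddfs" "g \<in> ddfs" for A g
    using that by (rule tensor_Sup_left[OF T L(1)])
  show "tensor L T (eps r p) (eps s q) = eps (L r s) (T p q)"
    if "p \<in> {0..1}" "q \<in> {0..1}" for r s p q
    using that by (rule tensor_eps[OF T(1) L])
qed

theorem is_tensor_unique:
  assumes T: "t_norm T" and F: "is_tensor L T F" and f: "f \<in> ddfs" and g: "g \<in> ddfs"
  shows "F f g = tensor L T f g"
proof -
  define A where "A = range (\<lambda>r. eps r (f r))"
  define B where "B = range (\<lambda>s. eps s (g s))"
  have I: "f r \<in> {0..1}" "g r \<in> {0..1}" for r
    using ddfsD(1,2)[OF f] ddfsD(1,2)[OF g] by auto
  have A: "A \<subseteq> ddfs" and B: "B \<subseteq> ddfs"
    using eps_in_ddfs I by (auto simp: A_def B_def)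
  have supA: "ddf_Sup A = f"
    unfolding A_def by (rule ddf_eq_Sup_eps[OF f, symmetric])
  have supB: "ddf_Sup B = g"
    unfolding B_def by (rule ddf_eq_Sup_eps[OF g, symmetric])
  have cl: "F a b \<in> ddfs" if "a \<in> ddfs" "b \<in> ddfs" for a b
  proof -
    have "\<forall>f\<in>ddfs. \<forall>g\<in>ddfs. F f g \<in> ddfs"
      using F unfolding is_tensor_def by (elim conjE)
    thus ?thesis using that by blast
  qed
  have 1: "F f g = ddf_Sup ((\<lambda>a. F a g) ` A)"
  proof -
    have "\<forall>A\<subseteq>ddfs. \<forall>g\<in>ddfs. F (ddf_Sup A) g = ddf_Sup ((\<lambda>f. F f g) ` A)"
      using F unfolding is_tensor_def by (elim conjE)
    hence "F (ddf_Sup A) g = ddf_Sup ((\<lambda>a. F a g) ` A)" using A g by blast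
    thus ?thesis by (simp only: supA)
  qed
  have 2: "F a g = ddf_Sup (F a ` B)" if "a \<in> A" for a
  proof -
    have "\<forall>f\<in>ddfs. \<forall>B\<subseteq>ddfs. F f (ddf_Sup B) = ddf_Sup (F f ` B)"
      using F unfolding is_tensor_def by (elim conjE)
    hence "F a (ddf_Sup B) = ddf_Sup (F a ` B)" using subsetD[OF A that] B by blast
    thus ?thesis by (simp only: supB)
  qed
  have 3: "F (eps r (f r)) (eps s (g s)) = eps (L r s) (T (f r) (g s))" for r s
  proof -
    have "\<forall>r s. \<forall>p\<in>{0..1}. \<forall>q\<in>{0..1}. F (eps r p) (eps s q) = eps (L r s) (T p q)"
      using F unfolding is_tensor_def by (elim conjE)
    thus ?thesis using I by blast
  qed
  show ?thesis
  proof (rule ddf_eqI)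
    show "F f g \<in> ddfs" by (rule cl[OF f g])
    show "tensor L T f g \<in> ddfs" by (rule tensor_in_ddfs[OF T f g])
    fix k assume k: "k \<in> ddfs"
    have s1: "(\<lambda>a. F a g) ` A \<subseteq> ddfs" using cl A g by auto
    have s2: "F a ` B \<subseteq> ddfs" if "a \<in> A" for a using cl A B that by auto
    have "F f g \<le> k \<longleftrightarrow> (\<forall>a\<in>A. F a g \<le> k)"
      unfolding 1 ddf_Sup_le_iff[OF s1 k] by simp
    also have "\<dots> \<longleftrightarrow> (\<forall>a\<in>A. \<forall>b\<in>B. F a b \<le> k)"
      using 2 ddf_Sup_le_iff[OF s2 k] by auto
    also have "\<dots> \<longleftrightarrow> (\<forall>r s. eps (L r s) (T (f r) (g s)) \<le> k)"
      unfolding A_def B_def by (auto simp: 3)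
    also have "\<dots> \<longleftrightarrow> tensor L T f g \<le> k"
      unfolding tensor_def ddf_Sup_le_iff[OF tensor_family[OF T f g] k] by blast
    finally show "F f g \<le> k \<longleftrightarrow> tensor L T f g \<le> k" .
  qed
qed

end

theory Submission
  imports Defs
begin

text \<open>Most triangle function axioms hold for \<open>tau T L\<close> whatever the t-conorm \<open>L\<close>: the
  index sets \<open>{(s, t). L s t = x}\<close> are never empty, since \<open>L x 0 = x\<close>, and \<open>T\<close> preserves
  suprema of non-empty sets, so a nested supremum collapses to one over triples and associativity of
  \<open>tau T L\<close> is that of \<open>T\<close> and \<open>L\<close> (\<open>tau_assoc\<close>). What can fail is
  left continuity of the values, and (LCS) is exactly what controls it.

  If (LCS) fails at \<open>L x y = L x' y' = z\<close>, then \<open>tau T L (eps x 1) (eps y 1)\<close> has value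
  \<open>1\<close> at \<open>z\<close>, seen at \<open>(x', y')\<close>, but vanishes below \<open>z\<close>, because there one of
  the two arguments has not passed its step; so it jumps from the left (\<open>LCS_if_tau_closed\<close>).

  At a finite positive \<open>x\<close> the tensor is the supremum of \<open>T (f r) (g s)\<close> over \<open>L r s < x\<close>,
  whereas \<open>tau T L\<close> uses \<open>L r s = x\<close>. Continuity of \<open>L\<close> allows \<open>r\<close> to be enlarged
  until \<open>L r s = x\<close>, so the tensor always lies below \<open>tau T L\<close> (\<open>tensor_le_tau\<close>).
  Conversely, if \<open>s\<close> and \<open>t\<close> are finite and positive, \<open>T (f s) (g t)\<close> is the supremum of its values at strictly smaller pairs \<open>(s', t')\<close>, and
  under (LCS) these satisfy \<open>L s' t' < x\<close> (\<open>tau_le_tensor\<close>). The tensor takes its values in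
  \<open>ddfs\<close> and has \<open>eps 0 1\<close> as identity, which supplies the remaining axioms once the two
  operations agree.\<close>


section \<open>The supremum defining \<open>tau\<close>\<close>

lemma tau_upper:
  assumes T: "t_norm T" and f: "range f \<subseteq> {0..1}" and g: "range g \<subseteq> {0..1}"
  shows "T (f s) (g t) \<le> tau T L f g (L s t)"
proof -
  have "T (f a) (g b) \<in> {0..1}" for a b
    using f g by (intro t_normD(1)[OF T] range_subsetD)
  hence "bdd_above {T (f a) (g b) | a b. L a b = L s t}"
    by (intro bdd_aboveI[of _ 1]) auto
  thus ?thesis unfolding tau_def by (intro cSup_upper) auto
qed

lemma tau_family_nonempty:
  assumes "t_conorm L"
  shows "{T (f s) (g t) | s t. L s t = x} \<noteq> {}"
proof -
  have "L x 0 = x" using assms by (simp add: t_conorm_def)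
  thus ?thesis by blast
qed

lemma tau_least:
  assumes "t_conorm L" "\<And>s t. L s t = x \<Longrightarrow> T (f s) (g t) \<le> c"
  shows "tau T L f g x \<le> c"
  unfolding tau_def using tau_family_nonempty[OF assms(1)]
proof (rule cSup_least)
  fix p assume "p \<in> {T (f s) (g t) | s t. L s t = x}"
  thus "p \<le> c" using assms(2) by blast
qed

lemma tau_range:
  assumes T: "t_norm T" and L: "t_conorm L"
    and f: "range f \<subseteq> {0..1}" and g: "range g \<subseteq> {0..1}"
  shows "range (tau T L f g) \<subseteq> {0..1}"
proof -
  have I: "T (f a) (g b) \<in> {0..1}" for a b
    using f g by (intro t_normD(1)[OF T] range_subsetD)
  have "tau T L f g x \<in> {0..1}" for x
  proof -
    have "L x 0 = x" using L by (simp add: t_conorm_def)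
    hence "T (f x) (g 0) \<le> tau T L f g x" using tau_upper[OF T f g, of x 0 L] by simp
    moreover have "tau T L f g x \<le> 1" using I by (intro tau_least[OF L]) auto
    ultimately show ?thesis using I[of x 0] by auto
  qed
  thus ?thesis by auto
qed

lemma ddfs_range: "f \<in> ddfs \<Longrightarrow> range f \<subseteq> {0..1}"
  by (simp add: ddfs_def)


section \<open>Axioms that hold without (LCS)\<close>

lemma tau_commute:
  assumes T: "t_norm T" and L: "t_conorm L"
    and f: "range f \<subseteq> {0..1}" and g: "range g \<subseteq> {0..1}"
  shows "tau T L f g = tau T L g f"
proof
  fix x
  have "T (f s) (g t) = T (g t) (f s)" for s t
    using f g by (intro t_normD(2)[OF T] range_subsetD)
  moreover have "L s t = x \<longleftrightarrow> L t s = x" for s t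
    using t_conormD(4)[OF L, of s t] by simp
  ultimately have "{T (f s) (g t) | s t. L s t = x} = {T (g t) (f s) | s t. L t s = x}"
    by simp
  also have "\<dots> = {T (g s) (f t) | s t. L s t = x}" by blast
  finally show "tau T L f g x = tau T L g f x" by (simp add: tau_def)
qed

lemma tau_mono:
  assumes T: "t_norm T" and L: "t_conorm L"
    and ranges: "range f \<subseteq> {0..1}" "range f' \<subseteq> {0..1}" "range g \<subseteq> {0..1}" "range g' \<subseteq> {0..1}"
    and le: "f \<le> f'" "g \<le> g'"
  shows "tau T L f g \<le> tau T L f' g'"
proof (intro le_funI tau_least[OF L])
  fix x s t assume x: "L s t = x"
  have "T (f s) (g t) \<le> T (f' s) (g' t)"
    by (rule t_normD(4)[OF T ranges(1,3,2,4)[THEN range_subsetD] le_funD[OF le(1)] le_funD[OF le(2)]])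
  also have "\<dots> \<le> tau T L f' g' x"
    using tau_upper[OF T ranges(2,4), of s t L] x by simp
  finally show "T (f s) (g t) \<le> tau T L f' g' x" .
qed

text \<open>Left continuity of \<open>T\<close> moves the inner supremum outside, which leaves terms indexed by
  triples with \<open>L (L s t) v = x\<close>; each is one of the terms of the other bracketing.\<close>

lemma tau_assoc_le:
  assumes T: "t_norm T" "left_continuous_op T" and L: "t_conorm L"
    and f: "range f \<subseteq> {0..1}" and g: "range g \<subseteq> {0..1}" and h: "range h \<subseteq> {0..1}"
  shows "tau T L (tau T L f g) h \<le> tau T L f (tau T L g h)"
proof (intro le_funI tau_least[OF L])
  fix x u v assume x: "L u v = x"
  have gh: "range (tau T L g h) \<subseteq> {0..1}" by (rule tau_range[OF T(1) L g h])
  note I = f[THEN range_subsetD] g[THEN range_subsetD] h[THEN range_subsetD]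
    gh[THEN range_subsetD]
  have "T (Sup {T (f s) (g t) | s t. L s t = u}) (h v) \<le> tau T L f (tau T L g h) x"
  proof (rule t_norm_Sup_le[OF T _ tau_family_nonempty[OF L]])
    show "{T (f s) (g t) | s t. L s t = u} \<subseteq> {0..1}"
      using t_normD(1)[OF T(1) I(1) I(2)] by blast
    show "h v \<in> {0..1}" by (rule I)
    fix p assume "p \<in> {T (f s) (g t) | s t. L s t = u}"
    then obtain s t where p: "p = T (f s) (g t)" and u: "L s t = u" by blast
    have "T p (h v) = T (f s) (T (g t) (h v))"
      using T(1) I(1-3) unfolding p t_norm_def by blast
    also have "\<dots> \<le> T (f s) (tau T L g h (L t v))"
      using I t_normD(1)[OF T(1) I(2) I(3)] tau_upper[OF T(1) g h]
      by (intro t_normD(4)[OF T(1)] order_refl)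
    also have "\<dots> \<le> tau T L f (tau T L g h) (L s (L t v))"
      by (rule tau_upper[OF T(1) f gh])
    also have "L s (L t v) = L (L s t) v" using L unfolding t_conorm_def by metis
    also have "\<dots> = x" using x u by simp
    finally show "T p (h v) \<le> tau T L f (tau T L g h) x" .
  qed
  thus "T (tau T L f g u) (h v) \<le> tau T L f (tau T L g h) x" by (simp add: tau_def[of T L f g])
qed

text \<open>The reverse inequality is the same one read backwards, by commutativity.\<close>

lemma tau_assoc:
  assumes T: "t_norm T" "left_continuous_op T" and L: "t_conorm L"
    and f: "range f \<subseteq> {0..1}" and g: "range g \<subseteq> {0..1}" and h: "range h \<subseteq> {0..1}"
  shows "tau T L (tau T L f g) h = tau T L f (tau T L g h)"
proof (rule antisym)
  note c = tau_commute[OF T(1) L] and r = tau_range[OF T(1) L]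
  have "tau T L f (tau T L g h) = tau T L (tau T L h g) f"
    using c[OF f r[OF g h]] c[OF g h] by simp
  also have "\<dots> \<le> tau T L h (tau T L g f)"
    by (rule tau_assoc_le[OF T L h g f])
  also have "\<dots> = tau T L (tau T L f g) h"
    using c[OF h r[OF g f]] c[OF f g] by simp
  finally show "tau T L f (tau T L g h) \<le> tau T L (tau T L f g) h" .
qed (rule tau_assoc_le[OF T L f g h])


section \<open>The identity of the tensor\<close>

text \<open>On step functions the identity law reduces to the identities of \<open>L\<close> and \<open>T\<close>, and every
  \<open>f\<close> is a supremum of step functions, which the tensor preserves.\<close>

lemma tensor_identity:
  assumes T: "t_norm T" "left_continuous_op T" and L: "t_conorm L" "right_continuous_op L"
    and f: "f \<in> ddfs"
  shows "tensor L T f (eps 0 1) = f"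
proof -
  let ?A = "range (\<lambda>r. eps r (f r))"
  have I: "f r \<in> {0..1}" for r using ddfsD(1,2)[OF f] by auto
  have "tensor L T (eps r (f r)) (eps 0 1) = eps r (f r)" for r
    using tensor_eps[OF T(1) L I, of 1 r r 0] T(1) L(1) I by (simp add: t_norm_def t_conorm_def)
  hence img: "(\<lambda>a. tensor L T a (eps 0 1)) ` ?A = ?A" by (simp add: image_image)
  have "tensor L T (ddf_Sup ?A) (eps 0 1) = ddf_Sup ((\<lambda>a. tensor L T a (eps 0 1)) ` ?A)"
    using eps_in_ddfs I by (intro tensor_Sup_left[OF T L(1)]) auto
  thus ?thesis by (simp only: img flip: ddf_eq_Sup_eps[OF f])
qed


section \<open>Comparison of \<open>tau\<close> with the tensor\<close>

lemma t_conorm_enlarge_left: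
  assumes L: "t_conorm L" "continuous_op L" and le: "L r s \<le> x"
  shows "\<exists>r'\<ge>r. L r' s = x"
proof -
  have "continuous_on UNIV ((\<lambda>(s, t). L s t) \<circ> (\<lambda>a. (a, s)))"
    using L(2) unfolding continuous_op_def
    by (intro continuous_on_compose continuous_intros) (auto intro: continuous_on_subset)
  hence "continuous_on {r..\<infinity>} (\<lambda>a. L a s)"
    by (auto simp: o_def intro: continuous_on_subset)
  moreover have "x \<le> L \<infinity> s" using t_conormD(2)[OF L(1)] by simp
  ultimately show ?thesis using IVT'[of "\<lambda>a. L a s" r x \<infinity>] le by auto
qed

lemma tensor_le_tau:
  assumes T: "t_norm T" and L: "t_conorm L" "continuous_op L"
    and f: "f \<in> ddfs" and g: "g \<in> ddfs"
  shows "tensor L T f g \<le> tau T L f g"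
proof (rule le_funI)
  fix x
  note R = ddfs_range[OF f] ddfs_range[OF g]
  let ?A = "{eps (L r s) (T (f r) (g s)) | r s. True}"
  have "tensor L T f g x = (SUP a\<in>?A. a x)"
    unfolding tensor_def by (rule ddf_Sup_pointwise[OF tensor_family[OF T f g]]) auto
  also have "\<dots> \<le> tau T L f g x"
  proof (rule cSUP_least)
    fix a assume "a \<in> ?A"
    then obtain r s where a: "a = eps (L r s) (T (f r) (g s))" by blast
    consider "x = \<infinity>" | "x \<noteq> \<infinity>" "L r s < x" | "x \<noteq> \<infinity>" "\<not> L r s < x" by blast
    thus "a x \<le> tau T L f g x"
    proof cases
      case 1
      have "T (f \<infinity>) (g \<infinity>) = 1" using ddfsD(5)[OF f] ddfsD(5)[OF g] T by (simp add: t_norm_def)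
      moreover have "L \<infinity> \<infinity> = \<infinity>" by (rule t_conormD(1)[OF L(1)])
      ultimately have "1 \<le> tau T L f g \<infinity>" using tau_upper[OF T R, of \<infinity> \<infinity> L] by simp
      thus ?thesis using 1 by (simp add: a eps_def)
    next
      case 2
      obtain r' where r': "r \<le> r'" "L r' s = x"
        using t_conorm_enlarge_left[OF L less_imp_le[OF 2(2)]] by blast
      have "T (f r) (g s) \<le> T (f r') (g s)"
        using ddfsD(1,2)[OF f] ddfsD(1,2)[OF g] ddfsD(3)[OF f r'(1)]
        by (intro t_normD(4)[OF T]) auto
      also have "\<dots> \<le> tau T L f g x" using tau_upper[OF T R, of r' s L] r'(2) by simp
      finally show ?thesis using 2 by (simp add: a eps_def)
    next
      case 3
      moreover have "0 \<le> tau T L f g x" using range_subsetD[OF tau_range[OF T L(1) R], of x] by simp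
      ultimately show ?thesis by (simp add: a eps_def)
    qed
  qed auto
  finally show "tensor L T f g x \<le> tau T L f g x" .
qed

text \<open>At a finite positive point the value of a d.d.f. is the supremum of its values strictly below,
  and a left continuous \<open>T\<close> preserves this supremum.\<close>

lemma t_norm_ddf_le:
  assumes T: "t_norm T" "left_continuous_op T" and f: "f \<in> ddfs" and q: "q \<in> {0..1}"
    and s: "0 < s" "s < \<infinity>" and le: "\<And>s'. s' < s \<Longrightarrow> T (f s') q \<le> c"
  shows "T (f s) q \<le> c"
proof -
  have "f s \<le> Sup (f ` {..<s})"
  proof (rule ccontr)
    assume "\<not> f s \<le> Sup (f ` {..<s})"
    then obtain y where y: "y < s" "Sup (f ` {..<s}) < f y"
      using ddfsD(6)[OF f s, of "Sup (f ` {..<s})"] by auto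
    moreover have "f y \<le> Sup (f ` {..<s})"
      using y ddfsD(2)[OF f] by (intro cSup_upper bdd_aboveI[of _ 1]) auto
    ultimately show False by simp
  qed
  moreover have "Sup (f ` {..<s}) \<le> f s"
    using s ddfsD(3)[OF f] by (intro cSup_least) (auto intro: less_imp_le)
  ultimately have eq: "f s = Sup (f ` {..<s})" by simp
  show ?thesis
    unfolding eq using s q le ddfsD(1,2)[OF f] by (intro t_norm_Sup_le[OF T]) auto
qed

lemma tau_le_tensor:
  assumes T: "t_norm T" "left_continuous_op T" and L: "t_conorm L" "LCS L"
    and f: "f \<in> ddfs" and g: "g \<in> ddfs"
  shows "tau T L f g \<le> tensor L T f g"
proof (intro le_funI tau_least[OF L(1)])
  fix x s t assume x: "L s t = x"
  have k: "tensor L T f g \<in> ddfs" by (rule tensor_in_ddfs[OF T(1) f g])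
  have I: "f a \<in> {0..1}" "g a \<in> {0..1}" for a
    using ddfsD(1,2)[OF f] ddfsD(1,2)[OF g] by auto
  have comm: "T (f a) (g b) = T (g b) (f a)" for a b by (rule t_normD(2)[OF T(1) I])
  have below: "T (f s') (g t') \<le> tensor L T f g x" if "L s' t' < x" "x < \<infinity>" for s' t'
    using tensor_le_iff[OF T(1) f g k] that by blast
  show "T (f s) (g t) \<le> tensor L T f g x"
  proof (cases "x = \<infinity>")
    case True
    thus ?thesis using t_normD(1)[OF T(1) I] ddfsD(5)[OF k] by simp
  next
    case False
    hence fin: "x < \<infinity>" by (simp flip: less_top)
    hence st: "s < \<infinity>" "t < \<infinity>"
      using x t_conormD(1,2)[OF L(1)] False by (auto simp flip: less_top)
    show ?thesis
    \<comment> \<open>At \<open>0\<close> there is nothing strictly below to approximate from, but there a d.d.f. vanishes.\<close>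
    proof (cases "s = 0 \<or> t = 0")
      case True
      hence "f s = 0 \<or> g t = 0" using ddfsD(4)[OF f] ddfsD(4)[OF g] by auto
      hence "T (f s) (g t) = 0"
        using t_normD(3)[OF T(1) I(2) I(2)[of t]] t_normD(3)[OF T(1) I(1) I(1)[of s]]
          comm[of s t] by auto
      thus ?thesis using ddfsD(1)[OF k] by simp
    next
      case False
      hence pos: "0 < s" "0 < t" by (auto simp: zero_less_iff_neq_zero)
      show ?thesis
      proof (rule t_norm_ddf_le[OF T f I(2) pos(1) st(1)])
        fix s' assume s': "s' < s"
        have "T (g t) (f s') \<le> tensor L T f g x"
        proof (rule t_norm_ddf_le[OF T g I(1) pos(2) st(2)])
          fix t' assume "t' < t"
          hence "L s' t' < x" using L(2) s' fin x unfolding LCS_def by blast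
          thus "T (g t') (f s') \<le> tensor L T f g x" using below[of s' t'] fin comm[of s' t'] by simp
        qed
        thus "T (f s') (g t) \<le> tensor L T f g x" using comm[of s' t] by simp
      qed
    qed
  qed
qed


section \<open>Necessity of (LCS)\<close>

lemma LCS_if_tau_closed:
  assumes T: "t_norm T" and L: "t_conorm L"
    and closed: "\<And>f g. f \<in> ddfs \<Longrightarrow> g \<in> ddfs \<Longrightarrow> tau T L f g \<in> ddfs"
  shows "LCS L"
  unfolding LCS_def
proof (intro allI impI, rule ccontr)
  fix x x' y y' assume *: "x < x' \<and> y < y' \<and> L x' y' < \<infinity>" and "\<not> L x y < L x' y'"
  hence z: "L x' y' \<le> L x y" by simp
  define f where "f = eps x 1"
  define g where "g = eps y 1"
  have f: "f \<in> ddfs" and g: "g \<in> ddfs" using eps_in_ddfs by (auto simp: f_def g_def)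
  note R = ddfs_range[OF f] ddfs_range[OF g]
  let ?h = "tau T L f g"
  have h: "?h \<in> ddfs" by (rule closed[OF f g])
  have "x' \<le> L x' y'"
    using t_conormD(3)[OF L, of x' x' 0 y'] L by (simp add: t_conorm_def)
  moreover have "0 < x'" using * by (auto intro: le_less_trans)
  ultimately have pos: "0 < L x' y'" by (rule less_le_trans[rotated])
  have "f x' = 1" "g y' = 1" using * by (auto simp: f_def g_def eps_def)
  moreover have "T 1 1 = 1" using T by (simp add: t_norm_def)
  ultimately have "1 \<le> ?h (L x' y')" using tau_upper[OF T R, of x' y' L] by simp
  hence "1 / 2 < ?h (L x' y')" by simp
  then obtain w where w: "w < L x' y'" "1 / 2 < ?h w"
    using ddfsD(6)[OF h pos] * by blast
  have "?h w \<le> 0"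
  proof (rule tau_least[OF L])
    fix s t assume st: "L s t = w"
    have "\<not> (x < s \<and> y < t)"
    proof
      assume "x < s \<and> y < t"
      hence "L x y \<le> L s t" by (intro t_conormD(3)[OF L]) auto
      thus False using z w(1) st by simp
    qed
    moreover have "s \<noteq> \<infinity>" "t \<noteq> \<infinity>" using st w(1) t_conormD(1,2)[OF L] by auto
    ultimately have "f s = 0 \<or> g t = 0" by (auto simp: f_def g_def eps_def)
    moreover have I: "f s \<in> {0..1}" "g t \<in> {0..1}" using R[THEN range_subsetD] by blast+
    ultimately have "T (f s) (g t) = 0"
      using t_normD(2)[OF T I] t_normD(3)[OF T I(1) I(1)] t_normD(3)[OF T I(2) I(2)] by auto
    thus "T (f s) (g t) \<le> 0" by simp
  qed
  thus False using w(2) by simp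
qed


section \<open>The equivalence\<close>

theorem theorem3p18:
  fixes T :: "real \<Rightarrow> real \<Rightarrow> real"
    and L :: "ennreal \<Rightarrow> ennreal \<Rightarrow> ennreal"
  assumes "t_norm T" and "left_continuous_op T"
    and "t_conorm L" and "continuous_op L"
  shows "(triangle_function (tau T L)
            \<longleftrightarrow> (\<forall>f\<in>ddfs. \<forall>g\<in>ddfs. tau T L f g = tensor L T f g))
       \<and> ((\<forall>f\<in>ddfs. \<forall>g\<in>ddfs. tau T L f g = tensor L T f g)
            \<longleftrightarrow> LCS L)"
proof -
  note T = assms(1,2) and L = assms(3,4)
  let ?agree = "\<forall>f\<in>ddfs. \<forall>g\<in>ddfs. tau T L f g = tensor L T f g"
  have triangle_LCS: "LCS L" if "triangle_function (tau T L)"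
    using that by (intro LCS_if_tau_closed[OF T(1) L(1)]) (simp add: triangle_function_def)
  have LCS_agree: ?agree if "LCS L"
    using tau_le_tensor[OF T L(1) that] tensor_le_tau[OF T(1) L] by (auto intro: antisym)
  have agree_triangle: "triangle_function (tau T L)" if agree: ?agree
    unfolding triangle_function_def
  proof (intro conjI ballI impI)
    fix f assume f: "f \<in> ddfs"
    have e: "eps 0 1 \<in> ddfs" by (rule eps_in_ddfs) simp
    have "tensor L T f (eps 0 1) = f"
      using tensor_identity[OF T L(1) continuous_imp_right_continuous_op[OF L(2)] f] .
    thus right: "tau T L f (eps 0 1) = f" using agree f e by simp
    thus "tau T L (eps 0 1) f = f"
      using tau_commute[OF T(1) L(1) ddfs_range[OF e] ddfs_range[OF f]] by simp
  next
    show "tau T L f g \<in> ddfs" if "f \<in> ddfs" "g \<in> ddfs" for f g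
      using agree tensor_in_ddfs[OF T(1) that, of L] that by simp
    show "tau T L (tau T L f g) h = tau T L f (tau T L g h)"
      if "f \<in> ddfs" "g \<in> ddfs" "h \<in> ddfs" for f g h
      using that ddfs_range by (intro tau_assoc[OF T L(1)])
    show "tau T L f g = tau T L g f" if "f \<in> ddfs" "g \<in> ddfs" for f g
      using that ddfs_range by (intro tau_commute[OF T(1) L(1)])
    show "tau T L f g \<le> tau T L f' g'"
      if "f \<in> ddfs" "f' \<in> ddfs" "g \<in> ddfs" "g' \<in> ddfs" "f \<le> f' \<and> g \<le> g'" for f f' g g'
      using that ddfs_range by (intro tau_mono[OF T(1) L(1)]) auto
  qed
  show ?thesis using triangle_LCS LCS_agree agree_triangle by blast
qed

end
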